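(* Consider the composite problem $F_*=\min_{x\in \mathrm{dom}\,\psi}\{F(x)=f(x)+\psi(x)\}$ with $f(x)=\max_{1\le i\le m} f_i(x)$, having an optimal solution $x_*$. Suppose that the $f_i$ are continuously differentiable and, for some $L_f\ge0$, $$f_i(y)\le f_i(x)+\langle\nabla f_i(x),y-x\rangle+\tfrac12L_f\|x-y\|_B^2,\qquad x,y\in\mathrm{dom}\,\psi,\ 1\le i\le m .$$ Let $x_0\in\mathrm{dom}\,\psi$ and let $\{x_k\}_{k\ge0}$ be generated by $x_{k+1}=\hat T_{x_k}(\lambda_k)$ with $\lambda_k\in\arg\min_{\lambda\ge0}\{\hat\varphi_{x_k}(\lambda)-\lambda[F(x_k)-F_*]\}$. Then $$\frac1T\sum_{k=1}^TF(x_k)-F_*\ \le\ \frac{1}{2T}L_f\|x_0-x_*\|_B^2,\qquad T\ge1.$$ If in addition, for some $\mu_f>0$, $$f_i(y)\ge f_i(x)+\langle\nabla f_i(x),y-x\rangle+\tfrac12\mu_f\|x-y\|_B^2,\qquad x,y\in\mathrm{dom}\,\psi,\ 1\le i\le m,$$ then $$\|x_k-x_*\|_B^2\ \le\ \Big(\frac{L_f}{\mu_f+L_f}\Big)^k\|x_0-x_*\|_B^2,\qquad k\ge0.$$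
   Context: $\mathbb{E}$ is a finite-dimensional real vector space with dual $\mathbb{E}^*$, $\langle s,x\rangle$ is the value of $s\in\mathbb{E}^*$ at $x\in\mathbb{E}$. $B:\mathbb{E}\to\mathbb{E}^*$ is a self-adjoint positive-definite linear operator and $\|x\|_B=\langle Bx,x\rangle^{1/2}$. The prox-function is $d(x)=\frac12\|x\|_B^2$, so its Bregman distance is $\beta_d(x,y)=\frac12\|x-y\|_B^2$. $\psi$ is a closed convex function; each $f_i$, $1\le i\le m$, is closed and convex on $\mathrm{dom}\,\psi$. The linearization of $f$ at $\bar x\in\mathrm{dom}\,\psi$ is $\ell_{\bar x}(x)=\max_{1\le i\le m}[f_i(\bar x)+\langle\nabla f_i(\bar x),x-\bar x\rangle]$. For $\bar x\in\mathrm{dom}\,\psi$ and $\lambda\ge0$, $$\hat\varphi_{\bar x}(\lambda)=\max_{x\in\mathrm{dom}\,\psi}\big\{\lambda[F(\bar x)-\ell_{\bar x}(x)-\psi(x)]-\tfrac12\|\bar x-x\|_B^2\big\},$$ and $\hat T_{\bar x}(\lambda)$ denotes its unique maximizer. The minimizers $\lambda_k$ in the step-size rule are assumed to exist. *)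

theory Defs
  imports "HOL-Analysis.Analysis"
begin

(* The dual space of 'a is 'a \<Rightarrow>\<^sub>L real; the value of a functional s at x is written s x
   (blinfun_apply is a declared coercion). The inner product that comes with the class
   euclidean_space plays no role; the geometry is given by B alone. *)

definition self_adjoint_pos_def :: "('a::euclidean_space \<Rightarrow> 'a \<Rightarrow>\<^sub>L real) \<Rightarrow> bool" where
  "self_adjoint_pos_def B \<longleftrightarrow>
     linear B \<and> (\<forall>x y. B x y = B y x) \<and> (\<forall>x. x \<noteq> 0 \<longrightarrow> B x x > 0)"

definition norm_op :: "('a::euclidean_space \<Rightarrow> 'a \<Rightarrow>\<^sub>L real) \<Rightarrow> 'a \<Rightarrow> real" where
  "norm_op B x = sqrt (B x x)"

definition edom :: "('a \<Rightarrow> ereal) \<Rightarrow> 'a set" where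
  "edom \<psi> = {x. \<psi> x < \<infinity>}"

definition closed_convex_fun :: "('a::euclidean_space \<Rightarrow> ereal) \<Rightarrow> bool" where
  "closed_convex_fun \<psi> \<longleftrightarrow>
     (\<forall>x. \<psi> x \<noteq> -\<infinity>) \<and>
     closed {(x, t::real). \<psi> x \<le> ereal t} \<and> convex {(x, t::real). \<psi> x \<le> ereal t}"

(* Closedness is relative to Q \<times> \<real>: this is implied by closedness of the epigraph over Q in the
   whole space, and also by f being the restriction to Q of a closed function, so it covers
   both conventions; the set Q itself need not be closed. *)
definition closed_convex_fun_on :: "'a::euclidean_space set \<Rightarrow> ('a \<Rightarrow> real) \<Rightarrow> bool" where
  "closed_convex_fun_on Q f \<longleftrightarrow>
     closedin (top_of_set (Q \<times> UNIV)) (epigraph Q f) \<and> convex_on Q f"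

(* g x is the gradient of f at x, an element of the dual space. Derivatives are taken within Q,
   so f need not be differentiable (or meaningful) outside Q; at an interior point this is the
   ordinary gradient. If Q has empty interior, any such choice g is admitted. *)
definition C1_on :: "'a::euclidean_space set \<Rightarrow> ('a \<Rightarrow> real) \<Rightarrow> ('a \<Rightarrow> 'a \<Rightarrow>\<^sub>L real) \<Rightarrow> bool" where
  "C1_on Q f g \<longleftrightarrow>
     (\<forall>x\<in>Q. (f has_derivative blinfun_apply (g x)) (at x within Q)) \<and> continuous_on Q g"

definition max_fun :: "nat \<Rightarrow> (nat \<Rightarrow> 'a \<Rightarrow> real) \<Rightarrow> 'a \<Rightarrow> real" where
  "max_fun m f x = Max ((\<lambda>i. f i x) ` {1..m})"

definition linearization ::
  "nat \<Rightarrow> (nat \<Rightarrow> 'a::euclidean_space \<Rightarrow> real) \<Rightarrow> (nat \<Rightarrow> 'a \<Rightarrow> 'a \<Rightarrow>\<^sub>L real) \<Rightarrow> 'a \<Rightarrow> 'a \<Rightarrow> real" where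
  "linearization m f g xb x = Max ((\<lambda>i. f i xb + g i xb (x - xb)) ` {1..m})"

(* Used only on edom \<psi>, where \<psi> is finite. *)
definition objective :: "nat \<Rightarrow> (nat \<Rightarrow> 'a \<Rightarrow> real) \<Rightarrow> ('a \<Rightarrow> ereal) \<Rightarrow> 'a \<Rightarrow> real" where
  "objective m f \<psi> x = max_fun m f x + real_of_ereal (\<psi> x)"

definition model ::
  "('a::euclidean_space \<Rightarrow> 'a \<Rightarrow>\<^sub>L real) \<Rightarrow> nat \<Rightarrow> (nat \<Rightarrow> 'a \<Rightarrow> real) \<Rightarrow> (nat \<Rightarrow> 'a \<Rightarrow> 'a \<Rightarrow>\<^sub>L real) \<Rightarrow>
   ('a \<Rightarrow> ereal) \<Rightarrow> 'a \<Rightarrow> real \<Rightarrow> 'a \<Rightarrow> real" where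
  "model B m f g \<psi> xb lam x =
     lam * (objective m f \<psi> xb - linearization m f g xb x - real_of_ereal (\<psi> x))
     - (norm_op B (xb - x))\<^sup>2 / 2"

(* The maximum over edom \<psi> is attained for lam \<ge> 0 and \<psi> closed convex. *)
definition phi_hat ::
  "('a::euclidean_space \<Rightarrow> 'a \<Rightarrow>\<^sub>L real) \<Rightarrow> nat \<Rightarrow> (nat \<Rightarrow> 'a \<Rightarrow> real) \<Rightarrow> (nat \<Rightarrow> 'a \<Rightarrow> 'a \<Rightarrow>\<^sub>L real) \<Rightarrow>
   ('a \<Rightarrow> ereal) \<Rightarrow> 'a \<Rightarrow> real \<Rightarrow> real" where
  "phi_hat B m f g \<psi> xb lam = (SUP x\<in>edom \<psi>. model B m f g \<psi> xb lam x)"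

definition T_hat ::
  "('a::euclidean_space \<Rightarrow> 'a \<Rightarrow>\<^sub>L real) \<Rightarrow> nat \<Rightarrow> (nat \<Rightarrow> 'a \<Rightarrow> real) \<Rightarrow> (nat \<Rightarrow> 'a \<Rightarrow> 'a \<Rightarrow>\<^sub>L real) \<Rightarrow>
   ('a \<Rightarrow> ereal) \<Rightarrow> 'a \<Rightarrow> real \<Rightarrow> 'a" where
  "T_hat B m f g \<psi> xb lam = (THE x. is_arg_max (model B m f g \<psi> xb lam) (\<lambda>y. y \<in> edom \<psi>) x)"

end

theory Submission
  imports Defs
begin

text \<open>Minimality of the step size \<open>\<lambda>\<^sub>k\<close> is the complementarity condition of the projection of
  \<open>x\<^sub>k\<close> onto the set where the linearized objective \<open>p\<close> is at most \<open>F\<^sub>*\<close>: it says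
  \<open>p (x\<^sub>k\<^sub>+\<^sub>1) \<le> F\<^sub>*\<close> and \<open>\<lambda>\<^sub>k (p (x\<^sub>k\<^sub>+\<^sub>1) - F\<^sub>*) = 0\<close>. By convexity \<open>p (x\<^sub>*) \<le> F\<^sub>*\<close>, so the
  three-point inequality of the proximal step shows that the squared distance to \<open>x\<^sub>*\<close> drops by
  at least the squared step length, while the descent inequality bounds \<open>F (x\<^sub>k\<^sub>+\<^sub>1) - F\<^sub>*\<close> by
  \<open>L\<^sub>f / 2\<close> times the squared step length. Telescoping gives the sublinear rate. Under strong
  convexity \<open>F (x\<^sub>k\<^sub>+\<^sub>1) - F\<^sub>*\<close> is in turn at least \<open>\<mu>\<^sub>f / 2\<close> times the squared distance of
  \<open>x\<^sub>k\<^sub>+\<^sub>1\<close> to \<open>x\<^sub>*\<close>, which gives the contraction.\<close>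

section \<open>The quadratic form of a self-adjoint positive-definite operator\<close>

context
  fixes B :: "'a::euclidean_space \<Rightarrow> 'a \<Rightarrow>\<^sub>L real"
  assumes spd: "self_adjoint_pos_def B"
begin

lemma self_adjoint_linear: "linear B"
  and self_adjoint_commute: "B x y = B y x"
  and self_adjoint_nonneg: "0 \<le> B x x"
  and self_adjoint_pos: "x \<noteq> 0 \<Longrightarrow> 0 < B x x"
proof -
  show *: "linear B" and "B x y = B y x" and pos: "x \<noteq> 0 \<Longrightarrow> 0 < B x x"
    using spd by (auto simp: self_adjoint_pos_def_def)
  show "0 \<le> B x x"
    using pos linear_0[OF *] by (cases "x = 0") auto
qed

lemma norm_op_power2: "(norm_op B x)\<^sup>2 = B x x"
  by (simp add: norm_op_def self_adjoint_nonneg)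

lemmas self_adjoint_simps =
  linear_add[OF self_adjoint_linear] linear_diff[OF self_adjoint_linear]
  linear_scale[OF self_adjoint_linear] linear_neg[OF self_adjoint_linear]
  linear_0[OF self_adjoint_linear] blinfun.bilinear_simps

lemma quadratic_form_minus_commute: "B (x - y) (x - y) = B (y - x) (y - x)"
  by (simp add: self_adjoint_simps)

lemma quadratic_form_scaleR: "B (r *\<^sub>R x) (r *\<^sub>R x) = r\<^sup>2 * B x x"
  by (simp add: self_adjoint_simps power2_eq_square)

lemma quadratic_form_diff_scaleR:
  "B (x - r *\<^sub>R y) (x - r *\<^sub>R y) = B x x - 2 * r * B y x + r\<^sup>2 * B y y"
  using self_adjoint_commute[of x y]
  by (simp add: self_adjoint_simps power2_eq_square algebra_simps)

text \<open>The last term is the exact modulus of strong convexity of the form; it becomes the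
  defect in \<open>prox_value_strongly_concave\<close>.\<close>

lemma quadratic_form_convex_combination:
  "B ((1 - t) *\<^sub>R u + t *\<^sub>R v - c) ((1 - t) *\<^sub>R u + t *\<^sub>R v - c)
     = (1 - t) * B (u - c) (u - c) + t * B (v - c) (v - c) - t * (1 - t) * B (v - u) (v - u)"
  using self_adjoint_commute[of u v] self_adjoint_commute[of u c] self_adjoint_commute[of v c]
  by (simp add: self_adjoint_simps algebra_simps)

text \<open>The form attains a positive minimum on the compact unit sphere, and homogeneity extends
  the bound. This turns estimates in \<open>B\<close> into Cauchy estimates in the norm.\<close>

lemma quadratic_form_lower_bound: obtains k where "k > 0" "\<And>x. k * (norm x)\<^sup>2 \<le> B x x"
proof -
  have cont: "continuous_on UNIV (\<lambda>x. B x x)"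
    using linear_continuous_on[of B] self_adjoint_linear linear_conv_bounded_linear
    by (intro continuous_intros) blast
  show ?thesis
  proof (cases "sphere 0 1 = ({} :: 'a set)")
    case True
    then show ?thesis by simp
  next
    case False
    then obtain w :: 'a where w: "norm w = 1" "\<And>y. norm y = 1 \<Longrightarrow> B w w \<le> B y y"
      using continuous_attains_inf[of "sphere 0 1" "\<lambda>x. B x x"] continuous_on_subset[OF cont]
      by auto
    show ?thesis
    proof (rule that)
      show "0 < B w w" using w(1) by (intro self_adjoint_pos) auto
      show "B w w * (norm x)\<^sup>2 \<le> B x x" for x
      proof (cases "x = 0")
        case False
        have "B w w \<le> B (x /\<^sub>R norm x) (x /\<^sub>R norm x)" using False by (intro w(2)) simp
        also have "\<dots> = B x x / (norm x)\<^sup>2"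
          by (simp add: self_adjoint_simps power2_eq_square divide_simps)
        finally show ?thesis using False by (simp add: field_simps)
      qed (simp add: self_adjoint_simps)
    qed
  qed
qed

lemma tendsto_quadratic_form:
  assumes "(u \<longlongrightarrow> a) F"
  shows "((\<lambda>n. B (u n) (u n)) \<longlongrightarrow> B a a) F"
proof -
  have "bounded_linear B" using self_adjoint_linear linear_conv_bounded_linear by blast
  then have "((\<lambda>n. B (u n)) \<longlongrightarrow> B a) F" using assms by (rule bounded_linear.tendsto)
  then show ?thesis using assms by (rule blinfun.tendsto)
qed

end


section \<open>Parametric proximal steps\<close>

text \<open>The quadratic lower bound around
  \<^term>\<open>c\<close> is what the descent inequality gives for the linearized objective; together with
  convexity it upgrades itself to a linear one, which makes all the maxima finite.\<close>

locale prox_problem =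
  fixes B :: "'a::euclidean_space \<Rightarrow> 'a \<Rightarrow>\<^sub>L real" and Q :: "'a set" and p :: "'a \<Rightarrow> real"
    and c :: 'a and L :: real
  assumes spd: "self_adjoint_pos_def B"
    and convex: "convex_on Q p"
    and closed: "\<And>u s a r. \<lbrakk>\<And>n. u n \<in> Q; \<And>n. p (u n) \<le> s n; u \<longlonglongrightarrow> a; s \<longlonglongrightarrow> r\<rbrakk>
      \<Longrightarrow> a \<in> Q \<and> p a \<le> r"
    and center: "c \<in> Q"
    and L_nonneg: "0 \<le> L"
    and lower_bound: "\<And>y. y \<in> Q \<Longrightarrow> - L / 2 * B (y - c) (y - c) \<le> p y"
begin

text \<open>The negated Lagrangian of projecting \<open>c\<close> onto the set where
  \<open>p\<close> is at most 0, with multiplier \<open>l\<close>; minimizing its supremum over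
  \<open>l >= 0\<close> is the dual problem.\<close>

definition prox_value :: "real \<Rightarrow> 'a \<Rightarrow> real" where
  "prox_value l y = - l * p y - B (y - c) (y - c) / 2"

abbreviation prox_point :: "real \<Rightarrow> 'a \<Rightarrow> bool" where
  "prox_point l \<equiv> is_arg_max (prox_value l) (\<lambda>y. y \<in> Q)"

lemma prox_point_iff: "prox_point l v \<longleftrightarrow> v \<in> Q \<and> (\<forall>y\<in>Q. prox_value l y \<le> prox_value l v)"
  by (auto simp: is_arg_max_def not_less)

section \<open>Strong concavity and uniqueness of maximizers\<close>

lemma convex_Q: "\<lbrakk>u \<in> Q; v \<in> Q; 0 \<le> t; t \<le> 1\<rbrakk> \<Longrightarrow> (1 - t) *\<^sub>R u + t *\<^sub>R v \<in> Q"
  using convex_on_imp_convex[OF convex] by (auto simp: convex_alt)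

lemma prox_value_strongly_concave:
  assumes "0 \<le> l" "u \<in> Q" "v \<in> Q" "0 \<le> t" "t \<le> 1"
  shows "(1 - t) * prox_value l u + t * prox_value l v + t * (1 - t) / 2 * B (v - u) (v - u)
           \<le> prox_value l ((1 - t) *\<^sub>R u + t *\<^sub>R v)"
proof -
  have "p ((1 - t) *\<^sub>R u + t *\<^sub>R v) \<le> (1 - t) * p u + t * p v"
    using convex_onD[OF convex] assms by blast
  from mult_left_mono[OF this \<open>0 \<le> l\<close>] show ?thesis
    unfolding prox_value_def quadratic_form_convex_combination[OF spd] by (simp add: field_simps)
qed

text \<open>On the segment from \<open>v\<close> to \<open>y\<close>, maximality of \<open>v\<close>
  bounds the strongly concave value from above; dividing by the weight \<open>1 - z\<close> of
  \<open>y\<close> and letting it tend to 0 leaves the full quadratic term.\<close>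

lemma prox_point_three_point:
  assumes "0 \<le> l" "prox_point l v" "y \<in> Q"
  shows "prox_value l y + B (y - v) (y - v) / 2 \<le> prox_value l v"
proof -
  have "z * (B (y - v) (y - v) / 2) \<le> prox_value l v - prox_value l y" if z: "0 < z" "z < 1" for z
  proof -
    have v: "v \<in> Q" using assms by (simp add: prox_point_iff)
    have "z * prox_value l v + (1 - z) * prox_value l y + (1 - z) * z / 2 * B (y - v) (y - v)
            \<le> prox_value l v"
      using prox_value_strongly_concave[of l v y "1 - z"] convex_Q[of v y "1 - z"] assms v z
      by (force simp: prox_point_iff)
    then have "(1 - z) * (z * (B (y - v) (y - v) / 2)) \<le> (1 - z) * (prox_value l v - prox_value l y)"
      by (simp add: algebra_simps)
    then show ?thesis using z by (simp add: mult_le_cancel_left)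
  qed
  then have "B (y - v) (y - v) / 2 \<le> prox_value l v - prox_value l y"
    by (rule field_le_mult_one_interval)
  then show ?thesis by simp
qed

lemma prox_point_unique:
  assumes "0 \<le> l" "prox_point l v" "prox_point l w"
  shows "v = w"
proof (rule ccontr)
  assume "v \<noteq> w"
  then have "0 < B (v - w) (v - w)" using self_adjoint_pos[OF spd] by simp
  moreover have "prox_value l v + B (v - w) (v - w) / 2 \<le> prox_value l w"
    using prox_point_three_point assms by (simp add: prox_point_iff)
  ultimately show False using assms(2,3) by (fastforce simp: prox_point_iff)
qed

section \<open>Existence of maximizers\<close>

lemma prox_point_zero: "prox_point 0 c"
  using center self_adjoint_nonneg[OF spd]
  by (auto simp: prox_point_iff prox_value_def linear_0[OF self_adjoint_linear[OF spd]])

text \<open>For \<open>l * L > 1\<close> the quadratic bound alone does not bound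
  \<open>prox_value l\<close>. Convexity extrapolates the bound at unit \<open>B\<close>-distance
  from \<open>c\<close> along the ray through \<open>y\<close>, which costs only a linear term in
  \<open>r\<close>.\<close>

lemma linear_lower_bound:
  assumes "y \<in> Q" and r: "r = sqrt (B (y - c) (y - c))" "1 \<le> r"
  shows "p c - r * (p c + L / 2) \<le> p y"
proof -
  define z where "z = (1 - 1 / r) *\<^sub>R c + (1 / r) *\<^sub>R y"
  have zc: "z - c = (1 / r) *\<^sub>R (y - c)" by (simp add: z_def algebra_simps)
  have rr: "B (y - c) (y - c) = r * r" using r self_adjoint_nonneg[OF spd] by simp
  have "B (z - c) (z - c) = 1"
    unfolding zc quadratic_form_scaleR[OF spd] rr using r by (simp add: power2_eq_square)
  moreover have "z \<in> Q" using convex_Q[OF center assms(1)] r by (simp add: z_def)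
  ultimately have "- L / 2 \<le> p z" using lower_bound[of z] by simp
  also have "p z \<le> (1 - 1 / r) * p c + 1 / r * p y"
    unfolding z_def using center assms r by (intro convex_onD[OF convex]) auto
  finally have "r * (- L / 2) \<le> r * ((1 - 1 / r) * p c + 1 / r * p y)"
    using r by (intro mult_left_mono) auto
  also have "\<dots> = r * p c - p c + p y" using r by (simp add: field_simps)
  finally show ?thesis by (simp add: algebra_simps)
qed

lemma prox_value_bdd_above:
  assumes "0 \<le> l"
  shows "bdd_above (prox_value l ` Q)"
proof -
  define D where "D = l * (p c + L / 2)"
  have "p c \<ge> 0" using lower_bound[OF center] by (simp add: self_adjoint_simps[OF spd])
  then have D: "0 \<le> D" using assms L_nonneg by (simp add: D_def)
  show ?thesis
  proof (rule bdd_aboveI2)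
    fix y assume y: "y \<in> Q"
    define r where "r = sqrt (B (y - c) (y - c))"
    have r0: "0 \<le> r" and rr: "B (y - c) (y - c) = r\<^sup>2"
      using self_adjoint_nonneg[OF spd] by (auto simp: r_def)
    \<comment> \<open>\<open>D\<^sup>2 / 2\<close> is the maximum of
      \<open>r * D - r\<^sup>2 / 2\<close> and serves beyond distance 1; \<open>l * L / 2\<close>
      serves within it, where \<open>lower_bound\<close> suffices.\<close>
    show "prox_value l y \<le> D\<^sup>2 / 2 + l * L / 2"
    proof (cases "1 \<le> r")
      case True
      have "l * (p c - r * (p c + L / 2)) \<le> l * p y"
        using linear_lower_bound[OF y r_def True] assms by (rule mult_left_mono)
      moreover have "0 \<le> l * p c" using assms \<open>p c \<ge> 0\<close> by simp
      moreover have "0 \<le> l * L" using assms L_nonneg by simp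
      moreover have "r * D \<le> D\<^sup>2 / 2 + r\<^sup>2 / 2"
        using zero_le_power2[of "D - r"] by (simp add: power2_eq_square algebra_simps)
      ultimately show ?thesis by (simp add: prox_value_def rr D_def algebra_simps)
    next
      case False
      then have "r\<^sup>2 \<le> 1" using r0 by (simp add: power_le_one)
      then have "- L / 2 \<le> p y"
        using lower_bound[OF y] mult_left_mono[of "r\<^sup>2" 1 "L / 2"] L_nonneg by (simp add: rr)
      from mult_left_mono[OF this assms] have "- (l * p y) \<le> l * L / 2" by simp
      moreover have "0 \<le> D\<^sup>2 / 2" "0 \<le> r\<^sup>2 / 2" by simp_all
      ultimately show ?thesis unfolding prox_value_def rr mult_minus_left by linarith
    qed
  qed
qed

text \<open>Strong concavity makes a maximizing sequence a Cauchy sequence.\<close>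

lemma prox_point_exists:
  assumes "0 \<le> l"
  obtains v where "prox_point l v"
proof (cases "l = 0")
  case True
  then show ?thesis using prox_point_zero that by blast
next
  case False
  then have l: "0 < l" using assms by simp
  define M where "M = (SUP y\<in>Q. prox_value l y)"
  have M: "prox_value l y \<le> M" if "y \<in> Q" for y
    unfolding M_def using that prox_value_bdd_above[OF assms] by (rule cSUP_upper)
  have "\<exists>y\<in>Q. M - inverse (real (Suc n)) < prox_value l y" for n
  proof -
    have "M - inverse (real (Suc n)) < (SUP y\<in>Q. prox_value l y)" unfolding M_def[symmetric] by simp
    then show ?thesis
      using less_cSUP_iff[of Q "prox_value l"] center prox_value_bdd_above[OF assms] by auto
  qed
  then obtain u where uQ: "\<And>n. u n \<in> Q"
    and u: "\<And>n. M - inverse (real (Suc n)) < prox_value l (u n)" by metis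
  obtain k where k: "k > 0" "\<And>x. k * (norm x)\<^sup>2 \<le> B x x"
    using quadratic_form_lower_bound[OF spd] by blast
  \<comment> \<open>At the midpoint the factor \<open>t * (1 - t) / 2\<close> is 1/8, whence the 8;
    \<open>k\<close> passes from the form to the norm.\<close>
  have gap: "(norm (u i - u j))\<^sup>2 \<le> 8 / k * inverse (real (Suc n))" if "i \<ge> n" "j \<ge> n" for i j n
  proof -
    have mono: "inverse (real (Suc i)) \<le> inverse (real (Suc n))" if "i \<ge> n" for i
      using that by (intro le_imp_inverse_le) auto
    have *: "M - inverse (real (Suc n)) \<le> prox_value l (u i)" if "i \<ge> n" for i
      using u[of i] mono[OF that] by linarith
    have "prox_value l (u j) / 2 + prox_value l (u i) / 2 + B (u i - u j) (u i - u j) / 8 \<le> M"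
      using prox_value_strongly_concave[OF assms uQ[of j] uQ[of i], of "1/2"]
        M[OF convex_Q[OF uQ[of j] uQ[of i], of "1/2"]] by simp
    with *[OF \<open>i \<ge> n\<close>] *[OF \<open>j \<ge> n\<close>] have "B (u i - u j) (u i - u j) \<le> 8 * inverse (real (Suc n))"
      by argo
    with k(2)[of "u i - u j"] have "k * (norm (u i - u j))\<^sup>2 \<le> 8 * inverse (real (Suc n))"
      by linarith
    then have "(norm (u i - u j))\<^sup>2 \<le> 8 * inverse (real (Suc n)) / k"
      using k(1) by (simp only: pos_le_divide_eq mult.commute)
    then show ?thesis by simp
  qed
  have "Cauchy u"
  proof (rule metric_CauchyI)
    fix e :: real assume e: "0 < e"
    have "(\<lambda>n. 8 / k * inverse (real (Suc n))) \<longlonglongrightarrow> 8 / k * 0"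
      by (intro tendsto_intros LIMSEQ_inverse_real_of_nat)
    then have "eventually (\<lambda>n. 8 / k * inverse (real (Suc n)) < e\<^sup>2) sequentially"
      using e by (intro order_tendstoD) auto
    then obtain n where n: "8 / k * inverse (real (Suc n)) < e\<^sup>2"
      by (auto simp: eventually_sequentially)
    have "dist (u i) (u j) < e" if "i \<ge> n" "j \<ge> n" for i j
    proof (rule power_less_imp_less_base[of _ 2])
      show "(dist (u i) (u j))\<^sup>2 < e\<^sup>2" using gap[OF that] n by (simp add: dist_norm)
    qed (use e in simp)
    then show "\<exists>N. \<forall>i\<ge>N. \<forall>j\<ge>N. dist (u i) (u j) < e" by blast
  qed
  then obtain v where v: "u \<longlonglongrightarrow> v" using Cauchy_convergent_iff convergent_def by blast
  \<comment> \<open>Near-maximality of \<open>u n\<close> solved for \<open>p (u n)\<close>, so that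
    \<open>closed\<close> yields the limit without continuity of \<open>p\<close>; the division
    needs \<open>l > 0\<close>.\<close>
  define s where "s n = (inverse (real (Suc n)) - M - B (u n - c) (u n - c) / 2) / l" for n
  have "s \<longlonglongrightarrow> (0 - M - B (v - c) (v - c) / 2) / l"
    unfolding s_def using v l
    by (intro tendsto_intros LIMSEQ_inverse_real_of_nat tendsto_quadratic_form[OF spd]) auto
  moreover have "p (u n) \<le> s n" for n
    using u[of n] l by (simp add: s_def prox_value_def pos_le_divide_eq mult.commute)
  ultimately have "v \<in> Q" "p v \<le> (0 - M - B (v - c) (v - c) / 2) / l"
    using closed[of u s] uQ v by blast+
  then have "v \<in> Q" "M \<le> prox_value l v"
    using l by (auto simp: prox_value_def pos_le_divide_eq mult.commute)
  moreover have "prox_value l y \<le> prox_value l v" if "y \<in> Q" for y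
    using M[OF that] \<open>M \<le> prox_value l v\<close> by (rule order_trans)
  ultimately have "prox_point l v" by (simp add: prox_point_iff)
  then show ?thesis by (rule that)
qed

lemma the_prox_point:
  assumes "0 \<le> l"
  shows "prox_point l (THE v. prox_point l v)"
proof -
  obtain v where v: "prox_point l v" using prox_point_exists[OF assms] .
  then show ?thesis using prox_point_unique[OF assms _ v] by (rule theI)
qed

section \<open>The optimal value as a function of the step size\<close>

lemma SUP_prox_value: "prox_point l v \<Longrightarrow> (SUP y\<in>Q. prox_value l y) = prox_value l v"
  by (rule cSup_eq_maximum) (simp add: prox_point_iff, fastforce simp: prox_point_iff)

text \<open>Comparing \<^term>\<open>l\<close> with \<^term>\<open>(1 + \<delta>) * l\<close>, the three-point inequality at \<^term>\<open>l\<close>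
  bounds the optimal value to second order in \<^term>\<open>\<delta>\<close>,
  so minimality over the step size forces the linear coefficient \<^term>\<open>l * p v\<close> to vanish.\<close>

lemma prox_value_perturb:
  assumes "0 \<le> l" "prox_point l v" "- 1 \<le> \<delta>" "y \<in> Q"
  shows "prox_value ((1 + \<delta>) * l) y
           \<le> prox_value l v - \<delta> * (l * p v) + \<delta>\<^sup>2 / 2 * B (v - c) (v - c)"
proof -
  let ?s = "B (y - v) (y - v)" and ?i = "B (v - c) (y - v)" and ?n = "B (v - c) (v - c)"
  have y: "B (y - c) (y - c) = ?n + 2 * ?i + ?s"
    using self_adjoint_commute[OF spd, of y v] self_adjoint_commute[OF spd, of y c]
      self_adjoint_commute[OF spd, of v c]
    by (simp add: self_adjoint_simps[OF spd])
  \<comment> \<open>Young's inequality for the cross term \<open>?i\<close>, weighted so that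
    \<open>?s\<close> cancels against the three-point term.\<close>
  have "0 \<le> B (y - v - \<delta> *\<^sub>R (v - c)) (y - v - \<delta> *\<^sub>R (v - c))"
    by (rule self_adjoint_nonneg[OF spd])
  also have "\<dots> = ?s - 2 * \<delta> * ?i + \<delta>\<^sup>2 * ?n"
    by (rule quadratic_form_diff_scaleR[OF spd])
  finally have i: "2 * \<delta> * ?i \<le> ?s + \<delta>\<^sup>2 * ?n" by simp
  have "prox_value ((1 + \<delta>) * l) y = (1 + \<delta>) * prox_value l y + \<delta> / 2 * B (y - c) (y - c)"
    by (simp add: prox_value_def algebra_simps)
  also have "\<dots> \<le> (1 + \<delta>) * (prox_value l v - ?s / 2) + \<delta> / 2 * B (y - c) (y - c)"
    using prox_point_three_point[OF assms(1,2,4)] assms(3)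
    by (intro add_right_mono mult_left_mono) auto
  also have "\<dots> = prox_value l v - \<delta> * (l * p v) + (2 * \<delta> * ?i - ?s) / 2"
    unfolding y by (simp add: prox_value_def field_simps)
  also have "\<dots> \<le> prox_value l v - \<delta> * (l * p v) + \<delta>\<^sup>2 / 2 * ?n"
    using i by simp
  finally show ?thesis .
qed

text \<open>Optimality conditions for the multiplier. A nonzero slope is excluded by a relative
  change of \<open>l\<close>; such changes fix \<open>l = 0\<close>, which is tested against a small
  positive step instead.\<close>

lemma optimal_step_complementarity:
  assumes l: "is_arg_min (\<lambda>l. SUP y\<in>Q. prox_value l y) (\<lambda>l. 0 \<le> l) l" and v: "prox_point l v"
  shows "l * p v = 0" "p v \<le> 0"
proof -
  have l0: "0 \<le> l" using l by (simp add: is_arg_min_def)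
  have min: "prox_value l v \<le> prox_value l' v'" if "0 \<le> l'" "prox_point l' v'" for l' v'
    using l that SUP_prox_value[OF v] SUP_prox_value[OF that(2)]
    by (auto simp: is_arg_min_def not_less)
  show slope: "l * p v = 0"
  proof (rule ccontr)
    define a n where "a = l * p v" and "n = B (v - c) (v - c)"
    assume "l * p v \<noteq> 0"
    then have a: "a \<noteq> 0" by (simp add: a_def)
    have n: "0 \<le> n" unfolding n_def by (rule self_adjoint_nonneg[OF spd])
    \<comment> \<open>\<open>\<delta>\<close> has the sign of \<open>a\<close> and absolute value at
      most 1, so the changed step stays nonnegative; the first-order gain
      \<open>\<delta> * a\<close> exceeds the second-order loss
      \<open>\<delta>\<^sup>2 / 2 * n\<close>.\<close>
    define \<delta> where "\<delta> = a / (n + \<bar>a\<bar>)"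
    have pos: "0 < n + \<bar>a\<bar>" using a n by simp
    have \<delta>: "- 1 \<le> \<delta>" using pos n unfolding \<delta>_def by (simp add: pos_le_divide_eq)
    then have l': "0 \<le> (1 + \<delta>) * l" using l0 by simp
    obtain w where w: "prox_point ((1 + \<delta>) * l) w" using prox_point_exists[OF l'] .
    then have "prox_value l v \<le> prox_value l v - \<delta> * a + \<delta>\<^sup>2 / 2 * n"
      using min[OF l' w] prox_value_perturb[OF l0 v \<delta>, of w]
      by (simp add: prox_point_iff a_def n_def)
    then have "\<delta> * a \<le> \<delta>\<^sup>2 / 2 * n" by simp
    moreover have "\<delta> * a = \<delta>\<^sup>2 * (n + \<bar>a\<bar>)"
      using pos by (simp add: \<delta>_def power2_eq_square)
    moreover have "\<delta>\<^sup>2 * (n / 2) < \<delta>\<^sup>2 * (n + \<bar>a\<bar>)"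
      using a n pos by (intro mult_strict_left_mono) (auto simp: \<delta>_def)
    ultimately show False by simp
  qed
  show "p v \<le> 0"
  proof (cases "l = 0")
    case False
    then show ?thesis using slope by simp
  next
    case True
    have vc: "v = c"
      using prox_point_unique[OF l0 v] prox_point_zero True by simp
    \<comment> \<open>With \<open>e * L < 1\<close> the proximal term outweighs the quadratic lower
      bound on \<open>e * p\<close>, so a nonnegative maximum forces the maximizer back to
      \<open>c\<close>.\<close>
    define e where "e = 1 / (L + 1)"
    have e: "0 < e" "e * L < 1" using L_nonneg by (auto simp: e_def)
    obtain w where w: "prox_point e w" using prox_point_exists[of e] e by auto
    have ge: "0 \<le> prox_value e w"
      using min[OF _ w] e vc True by (simp add: prox_value_def self_adjoint_simps[OF spd])
    have "e * (- L / 2 * B (w - c) (w - c)) \<le> e * p w"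
      using lower_bound[of w] w e by (intro mult_left_mono) (auto simp: prox_point_iff)
    then have "(1 - e * L) * B (w - c) (w - c) \<le> 0"
      using ge by (simp add: prox_value_def algebra_simps)
    then have "B (w - c) (w - c) \<le> 0" using e by (simp add: mult_le_0_iff)
    then have "w = c" using self_adjoint_pos[OF spd, of "w - c"] by fastforce
    then show ?thesis
      using ge e vc by (simp add: prox_value_def self_adjoint_simps[OF spd] mult_le_0_iff)
  qed
qed

text \<open>The Pythagorean inequality of a projection: in the three-point inequality
  complementarity removes \<open>l * p v\<close>, and \<open>l * p y\<close> has the favorable
  sign.\<close>

lemma optimal_step_decrease:
  assumes l: "is_arg_min (\<lambda>l. SUP y\<in>Q. prox_value l y) (\<lambda>l. 0 \<le> l) l" and v: "prox_point l v"
    and y: "y \<in> Q" "p y \<le> 0"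
  shows "B (v - y) (v - y) + B (v - c) (v - c) \<le> B (c - y) (c - y)"
proof -
  have l0: "0 \<le> l" using l by (simp add: is_arg_min_def)
  have "l * p y \<le> 0" using l0 y(2) by (simp add: mult_le_0_iff)
  then show ?thesis
    using prox_point_three_point[OF l0 v y(1)] optimal_step_complementarity(1)[OF l v]
      quadratic_form_minus_commute[OF spd, of y v] quadratic_form_minus_commute[OF spd, of y c]
    by (simp add: prox_value_def)
qed

end

section \<open>Composite objectives\<close>

text \<open>The segment lies in \<open>S\<close>, so \<open>D (v - u)\<close> is a one-sided
  derivative along it even if \<open>S\<close> has empty interior; convexity bounds the difference
  quotients by \<open>h v - h u\<close>.\<close>

lemma convex_on_above_tangent_within:
  assumes "convex_on S h" "u \<in> S" "v \<in> S" "(h has_derivative D) (at u within S)"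
  shows "h u + D (v - u) \<le> h v"
proof -
  define line where "line t = u + t *\<^sub>R (v - u)" for t :: real
  have line: "line t \<in> S" "h (line t) \<le> h u + t * (h v - h u)" if "t \<in> {0..1}" for t
  proof -
    have eq: "line t = (1 - t) *\<^sub>R u + t *\<^sub>R v" by (simp add: line_def algebra_simps)
    show "line t \<in> S"
      unfolding eq using convex_on_imp_convex[OF assms(1)] assms that by (auto simp: convex_alt)
    have "h (line t) \<le> (1 - t) * h u + t * h v"
      unfolding eq using assms that by (intro convex_onD[OF assms(1)]) auto
    then show "h (line t) \<le> h u + t * (h v - h u)" by (simp add: algebra_simps)
  qed
  have "(line has_derivative (\<lambda>t. t *\<^sub>R (v - u))) (at 0 within {0..1})"
    unfolding line_def by (auto intro!: derivative_eq_intros)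
  moreover have "(h has_derivative D) (at (line 0) within line ` {0..1})"
    using assms(4) line by (auto intro: has_derivative_subset simp: line_def[of 0])
  ultimately have "(h \<circ> line has_derivative D \<circ> (\<lambda>t. t *\<^sub>R (v - u))) (at 0 within {0..1})"
    by (rule diff_chain_within)
  moreover have "D \<circ> (\<lambda>t. t *\<^sub>R (v - u)) = (*) (D (v - u))"
    using linear_scale[OF has_derivative_linear[OF assms(4)]] by (auto simp: fun_eq_iff)
  ultimately have "(h \<circ> line has_field_derivative D (v - u)) (at 0 within {0..1})"
    by (simp add: has_field_derivative_def)
  then have lim: "((\<lambda>t. (h (line t) - h u) / t) \<longlongrightarrow> D (v - u)) (at 0 within {0..1})"
    by (simp add: has_field_derivative_iff line_def[of 0])
  have "eventually (\<lambda>t. (h (line t) - h u) / t \<le> h v - h u) (at 0 within {0..1})"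
    unfolding eventually_at_filter
  proof (intro always_eventually allI impI)
    fix t :: real assume "t \<noteq> 0" "t \<in> {0..1}"
    then show "(h (line t) - h u) / t \<le> h v - h u"
      using line(2)[of t] by (simp add: pos_divide_le_eq mult.commute)
  qed
  moreover have "at (0::real) within {0..1} \<noteq> bot"
    by (simp add: trivial_limit_within islimpt_Icc)
  ultimately have "D (v - u) \<le> h v - h u"
    using tendsto_upperbound[OF lim] by blast
  then show ?thesis by simp
qed

text \<open>Both ends are bounded from the intermediate point and averaged with weights
  \<open>1 - t\<close> and \<open>t\<close>: the gradient terms cancel and the quadratic
  coefficients add up to \<open>t * (1 - t)\<close>.\<close>

lemma strongly_convex_from_gradient:
  fixes D :: "'a::euclidean_space \<Rightarrow> 'a \<Rightarrow>\<^sub>L real"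
  assumes B: "self_adjoint_pos_def B"
    and grad: "\<And>u v. \<lbrakk>u \<in> S; v \<in> S\<rbrakk> \<Longrightarrow> h u + D u (v - u) + mu / 2 * B (u - v) (u - v) \<le> h v"
    and t: "0 \<le> t" "t \<le> 1"
    and S: "u \<in> S" "v \<in> S" "(1 - t) *\<^sub>R u + t *\<^sub>R v \<in> S"
  shows "h ((1 - t) *\<^sub>R u + t *\<^sub>R v) + mu / 2 * (t * (1 - t) * B (v - u) (v - u))
           \<le> (1 - t) * h u + t * h v"
proof -
  define z where "z = (1 - t) *\<^sub>R u + t *\<^sub>R v"
  have u: "u - z = (- t) *\<^sub>R (v - u)" and v: "v - z = (1 - t) *\<^sub>R (v - u)"
    by (auto simp: z_def algebra_simps)
  have Bu: "B (z - u) (z - u) = t * (t * B (v - u) (v - u))"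
    unfolding quadratic_form_minus_commute[OF B, of z u] u quadratic_form_scaleR[OF B]
    by (simp add: power2_eq_square)
  have Bv: "B (z - v) (z - v) = (1 - t) * ((1 - t) * B (v - u) (v - u))"
    unfolding quadratic_form_minus_commute[OF B, of z v] v quadratic_form_scaleR[OF B]
    by (simp add: power2_eq_square)
  define d where "d = D z (v - u)"
  have gu: "D z (u - z) = - t * d" and gv: "D z (v - z) = (1 - t) * d"
    unfolding u v d_def by (simp_all add: blinfun.bilinear_simps)
  have "(1 - t) * (h z + - t * d + mu / 2 * (t * (t * B (v - u) (v - u)))) \<le> (1 - t) * h u"
    using grad[of z u] S t Bu gu unfolding z_def[symmetric] by (intro mult_left_mono) auto
  moreover have "t * (h z + (1 - t) * d + mu / 2 * ((1 - t) * ((1 - t) * B (v - u) (v - u))))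
      \<le> t * h v"
    using grad[of z v] S t Bv gv unfolding z_def[symmetric] by (intro mult_left_mono) auto
  ultimately have "(1 - t) * (h z + - t * d + mu / 2 * (t * (t * B (v - u) (v - u))))
      + t * (h z + (1 - t) * d + mu / 2 * ((1 - t) * ((1 - t) * B (v - u) (v - u))))
      \<le> (1 - t) * h u + t * h v" by (rule add_mono)
  then show ?thesis unfolding z_def[symmetric]
    by (simp add: algebra_simps add_divide_distrib diff_divide_distrib)
qed

lemma closed_convex_fun_le_iff:
  assumes "closed_convex_fun \<psi>"
  shows "\<psi> y \<le> ereal r \<longleftrightarrow> y \<in> edom \<psi> \<and> real_of_ereal (\<psi> y) \<le> r"
  using assms by (cases "\<psi> y") (auto simp: closed_convex_fun_def edom_def)

lemma closed_convex_fun_imp_convex_on: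
  assumes "closed_convex_fun \<psi>"
  shows "convex_on (edom \<psi>) (\<lambda>y. real_of_ereal (\<psi> y))"
proof -
  have conv: "convex {(x, t::real). x \<in> edom \<psi> \<and> real_of_ereal (\<psi> x) \<le> t}"
    using assms by (auto simp: closed_convex_fun_def closed_convex_fun_le_iff[OF assms])
  have comb: "(1 - t) *\<^sub>R u + t *\<^sub>R v \<in> edom \<psi> \<and> real_of_ereal (\<psi> ((1 - t) *\<^sub>R u + t *\<^sub>R v))
      \<le> (1 - t) * real_of_ereal (\<psi> u) + t * real_of_ereal (\<psi> v)"
    if "u \<in> edom \<psi>" "v \<in> edom \<psi>" "0 \<le> t" "t \<le> 1" for u v t
    using convexD_alt[OF conv, of "(u, real_of_ereal (\<psi> u))" "(v, real_of_ereal (\<psi> v))" t] that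
    by simp
  show ?thesis
    by (rule convex_onI) (use comb in \<open>auto simp: convex_alt\<close>)
qed

section \<open>The linearized objective of the composite problem\<close>

context
  fixes B :: "'a::euclidean_space \<Rightarrow> 'a \<Rightarrow>\<^sub>L real"
    and m :: nat and f :: "nat \<Rightarrow> 'a \<Rightarrow> real" and g :: "nat \<Rightarrow> 'a \<Rightarrow> 'a \<Rightarrow>\<^sub>L real"
    and \<psi> :: "'a \<Rightarrow> ereal" and Lf Fopt :: real and xopt :: 'a
  assumes B: "self_adjoint_pos_def B"
    and m: "m \<ge> 1"
    and psi: "closed_convex_fun \<psi>"
    and convex_f: "\<And>i. i \<in> {1..m} \<Longrightarrow> convex_on (edom \<psi>) (f i)"
    and deriv_f: "\<And>i y. \<lbrakk>i \<in> {1..m}; y \<in> edom \<psi>\<rbrakk>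
      \<Longrightarrow> (f i has_derivative blinfun_apply (g i y)) (at y within edom \<psi>)"
    and opt: "is_arg_min (objective m f \<psi>) (\<lambda>y. y \<in> edom \<psi>) xopt"
    and Fopt: "Fopt = objective m f \<psi> xopt"
    and Lf: "Lf \<ge> 0"
    and upper: "\<And>i u v. \<lbrakk>i \<in> {1..m}; u \<in> edom \<psi>; v \<in> edom \<psi>\<rbrakk> \<Longrightarrow>
           f i v \<le> f i u + g i u (v - u) + Lf / 2 * B (u - v) (u - v)"
begin

text \<open>Subtracting \<open>Fopt\<close> puts the target level of the projection at 0.\<close>

definition gap_model :: "'a \<Rightarrow> 'a \<Rightarrow> real" where
  "gap_model c y = linearization m f g c y + real_of_ereal (\<psi> y) - Fopt"

lemma xopt_in: "xopt \<in> edom \<psi>" and Fopt_le: "y \<in> edom \<psi> \<Longrightarrow> Fopt \<le> objective m f \<psi> y"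
  using opt by (auto simp: is_arg_min_def Fopt not_less)

lemma max_fun_attained: obtains i where "i \<in> {1..m}" "max_fun m f y = f i y"
proof -
  have "max_fun m f y \<in> (\<lambda>i. f i y) ` {1..m}"
    unfolding max_fun_def using m by (intro Max_in) auto
  then show ?thesis using that by blast
qed

lemma max_fun_ge: "i \<in> {1..m} \<Longrightarrow> f i y \<le> max_fun m f y"
  by (auto simp: max_fun_def intro: Max_ge)

lemma linearization_attained:
  obtains i where "i \<in> {1..m}" "linearization m f g c y = f i c + g i c (y - c)"
proof -
  have "linearization m f g c y \<in> (\<lambda>i. f i c + g i c (y - c)) ` {1..m}"
    unfolding linearization_def using m by (intro Max_in) auto
  then show ?thesis using that by blast
qed

lemma linearization_ge: "i \<in> {1..m} \<Longrightarrow> f i c + g i c (y - c) \<le> linearization m f g c y"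
  unfolding linearization_def by (rule Max_ge) auto

lemma linearization_le_max_fun:
  assumes "c \<in> edom \<psi>" "y \<in> edom \<psi>"
  shows "linearization m f g c y \<le> max_fun m f y"
proof -
  obtain i where i: "i \<in> {1..m}" "linearization m f g c y = f i c + g i c (y - c)"
    using linearization_attained .
  then have "linearization m f g c y \<le> f i y"
    using convex_on_above_tangent_within[OF convex_f _ _ deriv_f] assms by simp
  also have "\<dots> \<le> max_fun m f y" using i by (intro max_fun_ge)
  finally show ?thesis .
qed

text \<open>The descent inequality is applied to the index attaining the maximum at
  \<open>y\<close>, whose affine piece lies below the linearization. This gives both the lower bound
  of the proximal problem and the estimate of the new objective value.\<close>

lemma objective_le_gap_model:
  assumes "c \<in> edom \<psi>" "y \<in> edom \<psi>"
  shows "objective m f \<psi> y - Fopt \<le> gap_model c y + Lf / 2 * B (y - c) (y - c)"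
proof -
  obtain i where i: "i \<in> {1..m}" "max_fun m f y = f i y" using max_fun_attained .
  then show ?thesis
    using upper[OF i(1) assms] linearization_ge[OF i(1), of c y]
      quadratic_form_minus_commute[OF B, of c y]
    by (simp add: objective_def gap_model_def)
qed

text \<open>Makes the optimal solution feasible for the projection at every
  \<open>c\<close>.\<close>

lemma gap_model_xopt: "c \<in> edom \<psi> \<Longrightarrow> gap_model c xopt \<le> 0"
  unfolding gap_model_def using linearization_le_max_fun[OF _ xopt_in, of c] Fopt
  by (simp add: objective_def)

lemma convex_on_gap_model: "convex_on (edom \<psi>) (gap_model c)"
proof (rule convex_onI)
  note psic = closed_convex_fun_imp_convex_on[OF psi]
  show "convex (edom \<psi>)" by (rule convex_on_imp_convex[OF psic])
  fix t u v assume t: "0 < (t::real)" "t < 1" and uv: "u \<in> edom \<psi>" "v \<in> edom \<psi>"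
  let ?z = "(1 - t) *\<^sub>R u + t *\<^sub>R v"
  obtain i where i: "i \<in> {1..m}" "linearization m f g c ?z = f i c + g i c (?z - c)"
    using linearization_attained .
  have "?z - c = (1 - t) *\<^sub>R (u - c) + t *\<^sub>R (v - c)" by (simp add: algebra_simps)
  then have "g i c (?z - c) = (1 - t) * g i c (u - c) + t * g i c (v - c)"
    by (simp only: blinfun.add_right blinfun.scaleR_right real_scaleR_def)
  then have "linearization m f g c ?z
      = (1 - t) * (f i c + g i c (u - c)) + t * (f i c + g i c (v - c))"
    unfolding i(2) by (simp add: left_diff_distrib distrib_left)
  also have "\<dots> \<le> (1 - t) * linearization m f g c u + t * linearization m f g c v"
    using i t by (intro add_mono mult_left_mono linearization_ge) auto
  finally show "gap_model c ?z \<le> (1 - t) * gap_model c u + t * gap_model c v"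
    using convex_onD[OF psic, of t u v] t uv by (simp add: gap_model_def algebra_simps)
qed

text \<open>Only the affine piece active at the limit \<open>a\<close> is kept: it is continuous,
  bounds the linearization from below along the sequence and is exact at \<open>a\<close>. The
  closed epigraph of \<open>\<psi>\<close> then also puts \<open>a\<close> into the domain, which
  need not be closed.\<close>

lemma gap_model_closed:
  assumes u: "\<And>n. u n \<in> edom \<psi>" "\<And>n. gap_model c (u n) \<le> s n" "u \<longlonglongrightarrow> a" "s \<longlonglongrightarrow> r"
  shows "a \<in> edom \<psi> \<and> gap_model c a \<le> r"
proof -
  obtain i where i: "i \<in> {1..m}" "linearization m f g c a = f i c + g i c (a - c)"
    using linearization_attained .
  define q where "q n = s n + Fopt - (f i c + g i c (u n - c))" for n
  have "q \<longlonglongrightarrow> r + Fopt - (f i c + g i c (a - c))"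
    unfolding q_def using u by (intro tendsto_intros)
  then have lim: "(\<lambda>n. (u n, q n)) \<longlonglongrightarrow> (a, r + Fopt - (f i c + g i c (a - c)))"
    using u(3) by (rule tendsto_Pair[rotated])
  have closed: "closed {(x, t::real). \<psi> x \<le> ereal t}"
    using psi by (simp add: closed_convex_fun_def)
  have "(u n, q n) \<in> {(x, t::real). \<psi> x \<le> ereal t}" for n
    using u(1,2)[of n] linearization_ge[OF i(1), of c "u n"]
    by (simp add: closed_convex_fun_le_iff[OF psi] q_def gap_model_def)
  then have "(a, r + Fopt - (f i c + g i c (a - c))) \<in> {(x, t::real). \<psi> x \<le> ereal t}"
    by (rule closed_sequentially[OF closed _ lim])
  then show ?thesis using i by (simp add: closed_convex_fun_le_iff[OF psi] gap_model_def)
qed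

lemma prox_problem_gap_model:
  assumes "c \<in> edom \<psi>"
  shows "prox_problem B (edom \<psi>) (gap_model c) c Lf"
proof
  show "- Lf / 2 * B (y - c) (y - c) \<le> gap_model c y" if "y \<in> edom \<psi>" for y
    using objective_le_gap_model[OF assms that] Fopt_le[OF that] by simp
  show "a \<in> edom \<psi> \<and> gap_model c a \<le> r"
    if "\<And>n. u n \<in> edom \<psi>" "\<And>n. gap_model c (u n) \<le> s n" "u \<longlonglongrightarrow> a" "s \<longlonglongrightarrow> r" for u s a r
    using that by (rule gap_model_closed)
qed (fact B convex_on_gap_model assms Lf)+

lemma step_progress:
  assumes c: "c \<in> edom \<psi>"
    and l: "is_arg_min (\<lambda>l. phi_hat B m f g \<psi> c l - l * (objective m f \<psi> c - Fopt)) (\<lambda>l. l \<ge> 0) l"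
  defines "v \<equiv> T_hat B m f g \<psi> c l"
  shows "v \<in> edom \<psi>"
    and "2 * (objective m f \<psi> v - Fopt)
           \<le> Lf * (B (c - xopt) (c - xopt) - B (v - xopt) (v - xopt))"
proof -
  interpret prox_problem B "edom \<psi>" "gap_model c" c Lf by (rule prox_problem_gap_model[OF c])
  \<comment> \<open>The shift is independent of \<open>y\<close>, so the maximizers agree;
    subtracting it turns the step-size rule into minimizing the supremum of
    \<open>prox_value\<close>.\<close>
  have model: "model B m f g \<psi> c l' y = l' * (objective m f \<psi> c - Fopt) + prox_value l' y" for l' y
    by (simp add: model_def prox_value_def norm_op_power2[OF B] gap_model_def
        quadratic_form_minus_commute[OF B, of c y] algebra_simps)
  have SUP: "phi_hat B m f g \<psi> c l' - l' * (objective m f \<psi> c - Fopt)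
      = (SUP y\<in>edom \<psi>. prox_value l' y)" if l': "0 \<le> l'" for l'
  proof -
    obtain w where w: "prox_point l' w" using prox_point_exists[OF l'] .
    then have "phi_hat B m f g \<psi> c l' = model B m f g \<psi> c l' w"
      unfolding phi_hat_def
      by (intro cSup_eq_maximum) (simp add: prox_point_iff, fastforce simp: prox_point_iff model)
    then show ?thesis using SUP_prox_value[OF w] by (simp add: model)
  qed
  have l': "is_arg_min (\<lambda>l. SUP y\<in>edom \<psi>. prox_value l y) (\<lambda>l. 0 \<le> l) l"
    using l SUP by (auto simp: is_arg_min_def)
  then have "0 \<le> l" by (simp add: is_arg_min_def)
  moreover have "is_arg_max (model B m f g \<psi> c l) (\<lambda>y. y \<in> edom \<psi>) = prox_point l"
    by (auto simp: is_arg_max_def model fun_eq_iff)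
  ultimately have v: "prox_point l v"
    using the_prox_point unfolding v_def T_hat_def by simp
  then show vin: "v \<in> edom \<psi>" by (simp add: prox_point_iff)
  have "objective m f \<psi> v - Fopt \<le> Lf / 2 * B (v - c) (v - c)"
    using objective_le_gap_model[OF c vin] optimal_step_complementarity(2)[OF l' v] by simp
  moreover have "Lf * B (v - c) (v - c) \<le> Lf * (B (c - xopt) (c - xopt) - B (v - xopt) (v - xopt))"
    using optimal_step_decrease[OF l' v xopt_in gap_model_xopt[OF c]] Lf
    by (intro mult_left_mono) auto
  ultimately show "2 * (objective m f \<psi> v - Fopt)
           \<le> Lf * (B (c - xopt) (c - xopt) - B (v - xopt) (v - xopt))" by simp
qed

text \<open>As \<open>\<psi>\<close> need not be differentiable, minimality is used through values
  on the segment from \<open>xopt\<close> to \<open>y\<close>: the strong convexity inequality is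
  divided by the weight \<open>t\<close> of \<open>y\<close>, which then tends to 0.\<close>

lemma quadratic_growth:
  assumes strong: "\<And>i u v. \<lbrakk>i \<in> {1..m}; u \<in> edom \<psi>; v \<in> edom \<psi>\<rbrakk> \<Longrightarrow>
      f i u + g i u (v - u) + mu / 2 * B (u - v) (u - v) \<le> f i v"
    and y: "y \<in> edom \<psi>"
  shows "mu * B (y - xopt) (y - xopt) \<le> 2 * (objective m f \<psi> y - Fopt)"
proof -
  note psic = closed_convex_fun_imp_convex_on[OF psi]
  let ?n = "B (y - xopt) (y - xopt)"
  have "s * (mu * ?n) \<le> 2 * (objective m f \<psi> y - Fopt)" if s: "0 < s" "s < 1" for s
  proof -
    define t where "t = 1 - s"
    have t: "0 < t" "t < 1" using s by (auto simp: t_def)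
    define z where "z = (1 - t) *\<^sub>R xopt + t *\<^sub>R y"
    have z: "z \<in> edom \<psi>"
      using convex_on_imp_convex[OF psic] xopt_in y t by (auto simp: z_def convex_alt)
    obtain i where i: "i \<in> {1..m}" "max_fun m f z = f i z" using max_fun_attained .
    have "f i z + mu / 2 * (t * (1 - t) * ?n) \<le> (1 - t) * f i xopt + t * f i y"
      unfolding z_def using z t xopt_in y i(1) strong
      by (intro strongly_convex_from_gradient[OF B, where S = "edom \<psi>" and D = "g i"])
        (auto simp: z_def)
    also have "\<dots> \<le> (1 - t) * max_fun m f xopt + t * max_fun m f y"
      using t i(1) by (intro add_mono mult_left_mono max_fun_ge) auto
    finally have "objective m f \<psi> z + mu / 2 * (t * (1 - t) * ?n)
        \<le> (1 - t) * objective m f \<psi> xopt + t * objective m f \<psi> y"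
      using convex_onD[OF psic, of t xopt y] t xopt_in y i(2)
      by (simp add: objective_def z_def algebra_simps)
    then have "t * (s * (mu * ?n)) \<le> t * (2 * (objective m f \<psi> y - Fopt))"
      using Fopt_le[OF z] by (simp add: Fopt t_def algebra_simps)
    then show ?thesis using t by (simp add: mult_le_cancel_left)
  qed
  then show ?thesis by (rule field_le_mult_one_interval)
qed

end

section \<open>The sublinear and the linear rate\<close>

theorem theorem2:
  fixes B :: "'a::euclidean_space \<Rightarrow> 'a \<Rightarrow>\<^sub>L real"
    and m :: nat
    and f :: "nat \<Rightarrow> 'a \<Rightarrow> real"
    and g :: "nat \<Rightarrow> 'a \<Rightarrow> 'a \<Rightarrow>\<^sub>L real"
    and \<psi> :: "'a \<Rightarrow> ereal"
    and Lf Fopt :: real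
    and xopt :: 'a
    and x :: "nat \<Rightarrow> 'a"
    and lam :: "nat \<Rightarrow> real"
  assumes "self_adjoint_pos_def B"
    and "m \<ge> 1"
    and "closed_convex_fun \<psi>"
    and "\<And>i. i \<in> {1..m} \<Longrightarrow> closed_convex_fun_on (edom \<psi>) (f i)"
    and "\<And>i. i \<in> {1..m} \<Longrightarrow> C1_on (edom \<psi>) (f i) (g i)"
    and "is_arg_min (objective m f \<psi>) (\<lambda>y. y \<in> edom \<psi>) xopt"
    and "Fopt = objective m f \<psi> xopt"
    and "Lf \<ge> 0"
    and "\<And>i u v. \<lbrakk>i \<in> {1..m}; u \<in> edom \<psi>; v \<in> edom \<psi>\<rbrakk> \<Longrightarrow>
           f i v \<le> f i u + g i u (v - u) + Lf / 2 * (norm_op B (u - v))\<^sup>2"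
    and "x 0 \<in> edom \<psi>"
    and "\<And>k. x (Suc k) = T_hat B m f g \<psi> (x k) (lam k)"
    and "\<And>k. is_arg_min
           (\<lambda>l. phi_hat B m f g \<psi> (x k) l - l * (objective m f \<psi> (x k) - Fopt)) (\<lambda>l. l \<ge> 0) (lam k)"
  shows "(\<forall>T::nat. T \<ge> 1 \<longrightarrow>
            1 / real T * (\<Sum>k=1..T. objective m f \<psi> (x k)) - Fopt
              \<le> 1 / (2 * real T) * Lf * (norm_op B (x 0 - xopt))\<^sup>2) \<and>
         (\<forall>mu::real. mu > 0 \<longrightarrow>
            (\<forall>i\<in>{1..m}. \<forall>u\<in>edom \<psi>. \<forall>v\<in>edom \<psi>.
               f i v \<ge> f i u + g i u (v - u) + mu / 2 * (norm_op B (u - v))\<^sup>2) \<longrightarrow>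
            (\<forall>k. (norm_op B (x k - xopt))\<^sup>2
                   \<le> (Lf / (mu + Lf)) ^ k * (norm_op B (x 0 - xopt))\<^sup>2))"
proof -
  note nsq = norm_op_power2[OF assms(1)]
  have cf: "\<And>i. i \<in> {1..m} \<Longrightarrow> convex_on (edom \<psi>) (f i)"
    using assms(4) by (simp add: closed_convex_fun_on_def)
  have df: "\<And>i y. \<lbrakk>i \<in> {1..m}; y \<in> edom \<psi>\<rbrakk>
      \<Longrightarrow> (f i has_derivative blinfun_apply (g i y)) (at y within edom \<psi>)"
    using assms(5) by (simp add: C1_on_def)
  note setting = assms(1-3) cf df assms(6-8) assms(9)[unfolded nsq]
  have progress: "T_hat B m f g \<psi> c l \<in> edom \<psi> \<and>
      2 * (objective m f \<psi> (T_hat B m f g \<psi> c l) - Fopt)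
        \<le> Lf * ((norm_op B (c - xopt))\<^sup>2 - (norm_op B (T_hat B m f g \<psi> c l - xopt))\<^sup>2)"
    if "c \<in> edom \<psi>"
      "is_arg_min (\<lambda>l. phi_hat B m f g \<psi> c l - l * (objective m f \<psi> c - Fopt)) (\<lambda>l. l \<ge> 0) l" for c l
    unfolding nsq using step_progress[OF setting that] by blast
  have x_in: "x k \<in> edom \<psi>" for k
  proof (induction k)
    case 0
    show ?case by (rule assms(10))
  next
    case (Suc k)
    show ?case using progress[OF Suc assms(12)] unfolding assms(11) by (rule conjunct1)
  qed
  define d where "d k = (norm_op B (x k - xopt))\<^sup>2" for k
  have step: "2 * (objective m f \<psi> (x (Suc k)) - Fopt) \<le> Lf * (d k - d (Suc k))" for k
    using progress[OF x_in assms(12), of k] unfolding d_def assms(11) by (rule conjunct2)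
  show ?thesis
  proof (intro conjI allI impI)
    fix T :: nat assume T: "T \<ge> 1"
    \<comment> \<open>\<open>step\<close> at \<open>k\<close> bounds the value at
      \<open>Suc k\<close>, so the sum starts at 1 while the telescoped distances start at
      \<open>d 0\<close>.\<close>
    have "2 * (\<Sum>k=1..T. objective m f \<psi> (x k) - Fopt) \<le> Lf * (d 0 - d T)"
    proof (induction T)
      case (Suc T)
      then show ?case using step[of T] by (simp add: algebra_simps)
    qed simp
    also have "\<dots> \<le> Lf * d 0"
      using assms(8) by (intro mult_left_mono) (auto simp: d_def)
    finally have *: "2 * ((\<Sum>k=1..T. objective m f \<psi> (x k)) - real T * Fopt) \<le> Lf * d 0"
      by (simp add: sum_subtractf)
    show "1 / real T * (\<Sum>k=1..T. objective m f \<psi> (x k)) - Fopt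
        \<le> 1 / (2 * real T) * Lf * (norm_op B (x 0 - xopt))\<^sup>2"
      using divide_right_mono[OF *, of "2 * real T"] T
      by (simp add: d_def diff_divide_distrib)
  next
    fix mu :: real and k :: nat
    assume mu: "mu > 0" and strong: "\<forall>i\<in>{1..m}. \<forall>u\<in>edom \<psi>. \<forall>v\<in>edom \<psi>.
               f i v \<ge> f i u + g i u (v - u) + mu / 2 * (norm_op B (u - v))\<^sup>2"
    have growth: "mu * d k \<le> 2 * (objective m f \<psi> (x k) - Fopt)" for k
      unfolding d_def nsq using strong x_in by (intro quadratic_growth[OF setting]) (auto simp: nsq)
    have contract: "d (Suc k) \<le> Lf / (mu + Lf) * d k" for k
    proof -
      have "(mu + Lf) * d (Suc k) \<le> Lf * d k"
        \<comment> \<open>\<open>growth\<close> is taken at \<open>Suc k\<close>, so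
          \<open>d (Suc k)\<close> can be collected on the left.\<close>
        using order_trans[OF growth step, of k] by (simp add: algebra_simps)
      then show ?thesis using mu assms(8) by (simp add: field_simps)
    qed
    have "d k \<le> (Lf / (mu + Lf)) ^ k * d 0"
    proof (induction k)
      case (Suc k)
      have "d (Suc k) \<le> Lf / (mu + Lf) * d k" by (rule contract)
      also have "\<dots> \<le> Lf / (mu + Lf) * ((Lf / (mu + Lf)) ^ k * d 0)"
        using Suc mu assms(8) by (intro mult_left_mono) auto
      finally show ?case by simp
    qed simp
    then show "(norm_op B (x k - xopt))\<^sup>2 \<le> (Lf / (mu + Lf)) ^ k * (norm_op B (x 0 - xopt))\<^sup>2"
      by (simp add: d_def)
  qed
qed

end
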